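(* There exists an absolute constant $\kappa>0$ such that for every dimension $n\ge 4$, every integer $m\ge 0$ and every family of $m$ valid linear cuts $\ell_1,\dots,\ell_m$ in dimension $n$, there exists a normalized submodular BCQP instance $(Q,c)\in\mathcal{N}_\infty^n$ such that the relaxation gap of the SDP relaxation with cuts $\ell_1,\dots,\ell_m$ is at least $\kappa\, n/(m+1)^2$ (i.e. the gap is $\Omega(n/(m+1)^2)$).
   Context: $\mathbb{S}^n$ is the space of real symmetric $n\times n$ matrices and $Q\bullet X=\sum_{i,j}Q_{ij}X_{ij}$. A submodular box-constrained quadratic program (BCQP) instance is a pair $(Q,c)\in\mathbb{S}^n\times\mathbb{R}^n$ with $Q_{ij}\le 0$ for all $i\ne j$; the problem is $\min\{x^\top Qx+c^\top x: x\in[0,1]^n\}$. The set of normalized instances is $$\mathcal{N}_\infty^n=\{(Q,c)\in\mathbb{S}^n\times\mathbb{R}^n:\ \max_{i,j}|Q_{ij}|\le 1,\ \|c\|_\infty\le 1,\ Q_{ij}\le 0\ \forall i\neq j\}.$$ Let $$\mathcal{S}_n=\Big\{(x,X)\in\mathbb{R}^n\times\mathbb{S}^n:\begin{pmatrix} 1 & x^\top \\ x & X \end{pmatrix}\succeq0\Big\}.$$ A valid linear cut is an inequality $\ell(x,X)\ge 0$ with $\ell(x,X)=c_0+\sum_i b_ix_i+\sum_i d_iX_{ii}+\sum_{1\le i<j\le n}h_{ij}X_{ij}$ such that $\ell(x,xx^\top)\ge 0$ for all $x\in[0,1]^n$. The SDP relaxation with cuts $\ell_1,\dots,\ell_m$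 is $$\min\{Q\bullet X+c^\top x:\ (x,X)\in\mathcal{S}_n,\ \ell_i(x,X)\ge 0,\ i=1,\dots,m\},$$ its value being understood as an infimum in $\mathbb{R}\cup\{-\infty\}$. The relaxation gap is the BCQP optimal value minus the SDP optimal value. *)

theory Defs
  imports "Jordan_Normal_Form.Matrix" "HOL-Library.Extended_Real"
begin

text \<open>
  Vectors and matrices are those of Jordan_Normal_Form, since the dimension \<open>n\<close> is quantified
  inside the statement.  Indices therefore run over \<open>0, \<dots>, n - 1\<close>.
\<close>

definition sym_mats :: "nat \<Rightarrow> real mat set" where
  "sym_mats n = {A \<in> carrier_mat n n. transpose_mat A = A}"

definition psd_mats :: "nat \<Rightarrow> real mat set" where
  "psd_mats n = {A \<in> sym_mats n. \<forall>v \<in> carrier_vec n. 0 \<le> v \<bullet> (A *\<^sub>v v)}"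

definition frobenius_prod :: "nat \<Rightarrow> real mat \<Rightarrow> real mat \<Rightarrow> real" where
  "frobenius_prod n Q X = (\<Sum>i<n. \<Sum>j<n. Q $$ (i, j) * X $$ (i, j))"

definition outer_square :: "real vec \<Rightarrow> real mat" where
  "outer_square x = mat (dim_vec x) (dim_vec x) (\<lambda>(i, j). x $ i * x $ j)"

definition unit_box :: "nat \<Rightarrow> real vec set" where
  "unit_box n = {x \<in> carrier_vec n. \<forall>i<n. 0 \<le> x $ i \<and> x $ i \<le> 1}"

definition normalized_instances :: "nat \<Rightarrow> (real mat \<times> real vec) set" where
  "normalized_instances n =
     {(Q, c). Q \<in> sym_mats n \<and> c \<in> carrier_vec n \<and>
        (\<forall>i<n. \<forall>j<n. \<bar>Q $$ (i, j)\<bar> \<le> 1) \<and>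
        (\<forall>i<n. \<bar>c $ i\<bar> \<le> 1) \<and>
        (\<forall>i<n. \<forall>j<n. i \<noteq> j \<longrightarrow> Q $$ (i, j) \<le> 0)}"

definition shor_set :: "nat \<Rightarrow> (real vec \<times> real mat) set" where
  "shor_set n =
     {(x, X). x \<in> carrier_vec n \<and> X \<in> sym_mats n \<and>
        four_block_mat (1\<^sub>m 1) (mat_of_row x) (transpose_mat (mat_of_row x)) X
          \<in> psd_mats (Suc n)}"

text \<open>
  Only the values of \<open>l\<close> on n-vectors and symmetric n-by-n matrices are constrained;
  these are also the only values that the relaxation below uses.
\<close>

definition cut_form :: "nat \<Rightarrow> (real vec \<Rightarrow> real mat \<Rightarrow> real) \<Rightarrow> bool" where
  "cut_form n l \<longleftrightarrow>
     (\<exists>(c0 :: real) (b :: nat \<Rightarrow> real) (d :: nat \<Rightarrow> real) (h :: nat \<Rightarrow> nat \<Rightarrow> real).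
        \<forall>x \<in> carrier_vec n. \<forall>X \<in> sym_mats n.
          l x X = c0 + (\<Sum>i<n. b i * x $ i) + (\<Sum>i<n. d i * X $$ (i, i))
                     + (\<Sum>j<n. \<Sum>i<j. h i j * X $$ (i, j)))"

definition valid_cut :: "nat \<Rightarrow> (real vec \<Rightarrow> real mat \<Rightarrow> real) \<Rightarrow> bool" where
  "valid_cut n l \<longleftrightarrow> cut_form n l \<and> (\<forall>x \<in> unit_box n. 0 \<le> l x (outer_square x))"

text \<open>
  The minimum over the box is attained and finite (compactness), so this infimum is the
  real optimal value.
\<close>

definition bcqp_value :: "nat \<Rightarrow> real mat \<Rightarrow> real vec \<Rightarrow> ereal" where
  "bcqp_value n Q c = (INF x \<in> unit_box n. ereal (x \<bullet> (Q *\<^sub>v x) + c \<bullet> x))"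

definition sdp_feasible ::
  "nat \<Rightarrow> nat \<Rightarrow> (nat \<Rightarrow> real vec \<Rightarrow> real mat \<Rightarrow> real) \<Rightarrow> (real vec \<times> real mat) set" where
  "sdp_feasible n m l = {(x, X). (x, X) \<in> shor_set n \<and> (\<forall>i<m. 0 \<le> l i x X)}"

definition sdp_value ::
  "nat \<Rightarrow> nat \<Rightarrow> (nat \<Rightarrow> real vec \<Rightarrow> real mat \<Rightarrow> real) \<Rightarrow> real mat \<Rightarrow> real vec \<Rightarrow> ereal" where
  "sdp_value n m l Q c =
     (INF (x, X) \<in> sdp_feasible n m l. ereal (frobenius_prod n Q X + c \<bullet> x))"

text \<open>
  For valid cuts, \<open>sdp_value\<close> is at most the finite \<open>bcqp_value\<close>.  The difference is thus
  well defined, and it is \<open>\<infinity>\<close> exactly when the relaxation is unbounded below.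
\<close>

definition relaxation_gap ::
  "nat \<Rightarrow> nat \<Rightarrow> (nat \<Rightarrow> real vec \<Rightarrow> real mat \<Rightarrow> real) \<Rightarrow> real mat \<Rightarrow> real vec \<Rightarrow> ereal" where
  "relaxation_gap n m l Q c = bcqp_value n Q c - sdp_value n m l Q c"

end

theory Submission
  imports Defs
begin

text \<open>
  The argument is a fooling-set argument in dimension four, copied \<open>n div 4\<close> times.

  Write \<open>(a, b, c, d)\<close> for a point of the cube \<open>[0,1]^4\<close> and let \<open>1/2 \<le> t \<le> 3/4\<close>.  The quadratic
  \<open>q_t = (a - b + c - d - t)^2 + 2c(1-a) + 2d(1-b) - d(1-a)\<close>
  has nonpositive mixed coefficients and is nonnegative on the cube.  It vanishes at one point on
  each of the four edges of the monotone path from \<open>(0,0,0,0)\<close> to \<open>(1,1,1,1)\<close> that raises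
  \<open>a\<close>, \<open>b\<close>, \<open>c\<close>, \<open>d\<close> in this order, and these zeros move along the edges with \<open>t\<close>.

  A pseudo-moment \<open>L_t\<close> makes \<open>q_t\<close> negative: mix the point masses at the four zeros with a
  small mass \<open>\<rho>\<close> at the apex \<open>(0,1,0,1)\<close>, the vertex where \<open>d(1-a)\<close> is positive although
  \<open>c(1-a)\<close> and \<open>d(1-b)\<close> vanish.  The square is large at the apex; to cancel it, the variance
  along three of the edges is made negative, of order \<open>\<rho>\<close>.  With the right amounts the
  affine function \<open>a - b + c - d - t\<close> lies in the kernel of the moment matrix, which stays positive
  semidefinite for small \<open>\<rho>\<close> (\<open>pseudo_form_nonneg\<close>), and \<open>L_t\<close> gives \<open>q_t\<close> the value
  \<open>- \<rho> / (4 + \<rho>)\<close> (\<open>block_objective_pseudo\<close>).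

  A negative variance of order \<open>\<rho>\<close> is repaired by averaging: if \<open>s\<close> and \<open>t\<close> differ by \<open>h\<close>, the
  edge means of \<open>L_s\<close> and \<open>L_t\<close> differ by at least \<open>h\<close>, so the average of the two
  pseudo-moments gains variance \<open>h^2/4\<close> on every edge.  For \<open>12 \<rho> \<le> h^2\<close> it is a moment matrix of
  an honest distribution on the cube, and no valid cut is negative on it.  Hence a valid cut
  excludes at most one of \<open>m + 1\<close> pseudo-moments with spacing \<open>h = 1 / (4(m + 1))\<close>
  (\<open>cut_cannot_violate_two_pseudo_moments\<close>), and \<open>m\<close> cuts leave one of them feasible.  With
  \<open>\<rho>\<close> of order \<open>h^2\<close> this gives a gap of order \<open>1 / (m + 1)^2\<close>.

  The factor \<open>n\<close> comes from repetition.  Giving coordinate \<open>i\<close> of an n-vector the value of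
  coordinate \<open>i mod 4\<close> maps points of the small cube to points of the large one, and so turns a
  cut in dimension \<open>n\<close> into a cut in dimension four.  The number of cuts is
  unchanged, while the objective, a sum of \<open>n div 4\<close> copies of \<open>q_t\<close> on disjoint blocks, multiplies
  the gap by \<open>n div 4\<close>.
\<close>

section \<open>Periodic vectors and matrices\<close>

definition periodic_vec :: "nat \<Rightarrow> (nat \<Rightarrow> real) \<Rightarrow> real vec" where
  "periodic_vec n y = vec n (\<lambda>i. y (i mod 4))"

definition periodic_mat :: "nat \<Rightarrow> (nat \<Rightarrow> nat \<Rightarrow> real) \<Rightarrow> real mat" where
  "periodic_mat n Y = mat n n (\<lambda>(i, j). Y (i mod 4) (j mod 4))"

lemma periodic_vec_simps [simp]:
  "periodic_vec n y \<in> carrier_vec n"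
  "dim_vec (periodic_vec n y) = n"
  "i < n \<Longrightarrow> periodic_vec n y $ i = y (i mod 4)"
  by (auto simp: periodic_vec_def)

lemma periodic_mat_simps [simp]:
  "periodic_mat n Y \<in> carrier_mat n n"
  "dim_row (periodic_mat n Y) = n"
  "dim_col (periodic_mat n Y) = n"
  "i < n \<Longrightarrow> j < n \<Longrightarrow> periodic_mat n Y $$ (i, j) = Y (i mod 4) (j mod 4)"
  by (simp_all add: periodic_mat_def)

lemma periodic_mat_sym:
  assumes "\<And>p q. Y p q = Y q p"
  shows "periodic_mat n Y \<in> sym_mats n"
  using assms by (auto simp: sym_mats_def)

lemma outer_square_periodic:
  "outer_square (periodic_vec n y) = periodic_mat n (\<lambda>p q. y p * y q)"
  by (rule eq_matI) (simp_all add: outer_square_def)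

lemma sum_lessThan_4: "(\<Sum>p<4. f p) = f 0 + f 1 + f 2 + f (3::nat)" for f :: "nat \<Rightarrow> real"
  by (simp add: eval_nat_numeral)

lemma sum_by_residue:
  fixes g :: "nat \<Rightarrow> real"
  shows "(\<Sum>i<n. f (i mod 4) * g i) = (\<Sum>p<4. f p * (\<Sum>i | i < n \<and> i mod 4 = p. g i))"
proof -
  have "(\<Sum>i<n. f (i mod 4) * g i) = (\<Sum>p<4. \<Sum>i | i \<in> {..<n} \<and> i mod 4 = p. f (i mod 4) * g i)"
    by (rule sum.group [symmetric]) auto
  also have "\<dots> = (\<Sum>p<4. f p * (\<Sum>i | i < n \<and> i mod 4 = p. g i))"
    by (auto simp: sum_distrib_left intro!: sum.cong)
  finally show ?thesis .
qed

text \<open>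
  The quadratic form of the large bordered matrix depends on its argument only through the sums of
  the entries in each residue class, so positive semidefiniteness of the bordered five-by-five
  matrix suffices.
\<close>

lemma periodic_in_shor_set:
  assumes sym: "\<And>p q. Y p q = Y q p"
    and psd: "\<And>v0 V. 0 \<le> v0\<^sup>2 + 2 * v0 * (\<Sum>p<4. y p * V p) + (\<Sum>p<4. \<Sum>q<4. Y p q * V q * V p)"
  shows "(periodic_vec n y, periodic_mat n Y) \<in> shor_set n"
proof -
  let ?x = "periodic_vec n y" and ?X = "periodic_mat n Y"
  define B where "B = four_block_mat (1\<^sub>m 1) (mat_of_row ?x) (transpose_mat (mat_of_row ?x)) ?X"
  have B_dim [simp]: "dim_row B = Suc n" "dim_col B = Suc n"
    by (simp_all add: B_def)
  have B00: "B $$ (0, 0) = 1" by (simp add: B_def)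
  have B0: "B $$ (0, Suc j) = y (j mod 4)" "B $$ (Suc j, 0) = y (j mod 4)" if "j < n" for j
    using that by (simp_all add: B_def)
  have BS: "B $$ (Suc i, Suc j) = Y (i mod 4) (j mod 4)" if "i < n" "j < n" for i j
    using that by (simp add: B_def)
  have B_sym: "transpose_mat B = B"
  proof (rule eq_matI)
    fix i j assume "i < dim_row B" "j < dim_col B"
    then show "transpose_mat B $$ (i, j) = B $$ (i, j)"
      by (cases i; cases j) (auto simp: B0 BS sym)
  qed auto
  have "0 \<le> v \<bullet> (B *\<^sub>v v)" if v: "v \<in> carrier_vec (Suc n)" for v
  proof -
    define V where "V p = (\<Sum>i | i < n \<and> i mod 4 = p. v $ Suc i)" for p
    have dim: "dim_vec v = Suc n" using v by simp
    have "v \<bullet> (B *\<^sub>v v) = (\<Sum>i<Suc n. v $ i * (\<Sum>j<Suc n. B $$ (i, j) * v $ j))"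
      using dim by (simp add: scalar_prod_def atLeast0LessThan del: sum.lessThan_Suc)
    also have "\<dots> = v $ 0 * (v $ 0 + (\<Sum>j<n. y (j mod 4) * v $ Suc j))
        + (\<Sum>i<n. v $ Suc i * (y (i mod 4) * v $ 0 + (\<Sum>j<n. Y (i mod 4) (j mod 4) * v $ Suc j)))"
      unfolding sum.lessThan_Suc_shift by (simp add: B00 B0 BS)
    also have "\<dots> = (v $ 0)\<^sup>2 + 2 * v $ 0 * (\<Sum>j<n. y (j mod 4) * v $ Suc j)
        + (\<Sum>i<n. (\<Sum>j<n. Y (i mod 4) (j mod 4) * v $ Suc j) * v $ Suc i)"
      by (simp add: distrib_left sum.distrib sum_distrib_left power2_eq_square mult_ac)
    also have "\<dots> = (v $ 0)\<^sup>2 + 2 * v $ 0 * (\<Sum>p<4. y p * V p)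
        + (\<Sum>p<4. (\<Sum>q<4. Y p q * V q) * V p)"
      unfolding sum_by_residue [where f = y]
        sum_by_residue [where f = "\<lambda>q. Y p q" for p]
        sum_by_residue [where f = "\<lambda>p. (\<Sum>q<4. Y p q * (\<Sum>i | i < n \<and> i mod 4 = q. v $ Suc i))"]
      by (simp add: V_def)
    also have "\<dots> = (v $ 0)\<^sup>2 + 2 * v $ 0 * (\<Sum>p<4. y p * V p)
        + (\<Sum>p<4. \<Sum>q<4. Y p q * V q * V p)"
      by (simp add: sum_distrib_right)
    finally show ?thesis using psd by simp
  qed
  moreover have "B \<in> carrier_mat (Suc n) (Suc n)"
    by (rule carrier_matI) simp_all
  ultimately have "B \<in> psd_mats (Suc n)"
    using B_sym by (simp add: psd_mats_def sym_mats_def)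
  then show ?thesis
    using periodic_mat_sym [of Y, OF sym] by (simp add: shor_set_def B_def)
qed

section \<open>Linear cuts on signed combinations\<close>

text \<open>
  A cut is affine in \<open>(x, X)\<close>, and affine functions respect combinations whose weights sum
  to 1.  The weights may be negative, as needed to express moments with negative variance.
\<close>

lemma cut_signed_combination:
  assumes "cut_form n l" and total: "(\<Sum>k\<in>K. w k) = 1"
    and sym: "\<And>k p q. Y k p q = Y k q p"
  shows "l (periodic_vec n (\<lambda>p. \<Sum>k\<in>K. w k * y k p)) (periodic_mat n (\<lambda>p q. \<Sum>k\<in>K. w k * Y k p q))
       = (\<Sum>k\<in>K. w k * l (periodic_vec n (y k)) (periodic_mat n (Y k)))"
proof -
  from assms(1) obtain c0 b d h where
    l: "\<And>x X. x \<in> carrier_vec n \<Longrightarrow> X \<in> sym_mats n \<Longrightarrow>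
          l x X = c0 + (\<Sum>i<n. b i * x $ i) + (\<Sum>i<n. d i * X $$ (i, i))
                     + (\<Sum>j<n. \<Sum>i<j. h i j * X $$ (i, j))"
    unfolding cut_form_def by blast
  have lp: "l (periodic_vec n z) (periodic_mat n Z) = c0 + (\<Sum>i<n. b i * z (i mod 4))
      + (\<Sum>i<n. d i * Z (i mod 4) (i mod 4)) + (\<Sum>j<n. \<Sum>i<j. h i j * Z (i mod 4) (j mod 4))"
    if "\<And>p q. Z p q = Z q p" for z Z
    using that by (subst l) (auto intro!: periodic_mat_sym sum.cong)
  have c0: "c0 = (\<Sum>k\<in>K. w k * c0)"
    using total by (simp flip: sum_distrib_right)
  have b: "(\<Sum>i<n. b i * (\<Sum>k\<in>K. w k * y k (i mod 4)))
      = (\<Sum>k\<in>K. w k * (\<Sum>i<n. b i * y k (i mod 4)))"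
    unfolding sum_distrib_left by (subst sum.swap) (simp add: mult_ac)
  have d: "(\<Sum>i<n. d i * (\<Sum>k\<in>K. w k * Y k (i mod 4) (i mod 4)))
      = (\<Sum>k\<in>K. w k * (\<Sum>i<n. d i * Y k (i mod 4) (i mod 4)))"
    unfolding sum_distrib_left by (subst sum.swap) (simp add: mult_ac)
  have h: "(\<Sum>j<n. \<Sum>i<j. h i j * (\<Sum>k\<in>K. w k * Y k (i mod 4) (j mod 4)))
      = (\<Sum>k\<in>K. w k * (\<Sum>j<n. \<Sum>i<j. h i j * Y k (i mod 4) (j mod 4)))"
    unfolding sum_distrib_left
    by (subst sum.swap [of _ _ K], rule sum.cong [OF refl], subst sum.swap) (simp add: mult_ac)
  have "l (periodic_vec n (\<lambda>p. \<Sum>k\<in>K. w k * y k p)) (periodic_mat n (\<lambda>p q. \<Sum>k\<in>K. w k * Y k p q))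
     = c0 + (\<Sum>i<n. b i * (\<Sum>k\<in>K. w k * y k (i mod 4)))
      + (\<Sum>i<n. d i * (\<Sum>k\<in>K. w k * Y k (i mod 4) (i mod 4)))
      + (\<Sum>j<n. \<Sum>i<j. h i j * (\<Sum>k\<in>K. w k * Y k (i mod 4) (j mod 4)))"
    by (rule lp) (simp add: sym)
  also have "\<dots> = (\<Sum>k\<in>K. w k * (c0 + (\<Sum>i<n. b i * y k (i mod 4))
      + (\<Sum>i<n. d i * Y k (i mod 4) (i mod 4)) + (\<Sum>j<n. \<Sum>i<j. h i j * Y k (i mod 4) (j mod 4))))"
    unfolding b d h by (subst c0) (simp add: distrib_left sum.distrib)
  also have "\<dots> = (\<Sum>k\<in>K. w k * l (periodic_vec n (y k)) (periodic_mat n (Y k)))"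
    by (subst lp) (auto simp: sym)
  finally show ?thesis .
qed

lemma valid_cut_nonneg:
  assumes "valid_cut n l" "\<And>p. 0 \<le> y p \<and> y p \<le> 1"
  shows "0 \<le> l (periodic_vec n y) (periodic_mat n (\<lambda>p q. y p * y q))"
proof -
  have "periodic_vec n y \<in> unit_box n"
    using assms(2) by (auto simp: unit_box_def)
  then show ?thesis
    using assms(1) by (auto simp: valid_cut_def simp flip: outer_square_periodic)
qed

section \<open>Edges of a monotone path in the cube\<close>

text \<open>
  Edge \<open>i\<close> of the path consists of the points whose first \<open>i\<close> coordinates are 1, whose coordinate
  \<open>i\<close> is free, and whose later coordinates are 0.
\<close>

definition edge_vec :: "nat \<Rightarrow> real \<Rightarrow> nat \<Rightarrow> real" where
  "edge_vec i a p = (if p < i then 1 else if p = i then a else 0)"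

text \<open>
  The second moments of a distribution on edge \<open>i\<close> whose free coordinate has mean \<open>a\<close> and second
  moment \<open>r\<close>.  The case \<open>r < a\<^sup>2\<close>, which no distribution realizes, is allowed.
\<close>

definition edge_mat :: "nat \<Rightarrow> real \<Rightarrow> real \<Rightarrow> nat \<Rightarrow> nat \<Rightarrow> real" where
  "edge_mat i a r p q = (if p = i \<and> q = i then r else edge_vec i a p * edge_vec i a q)"

lemma edge_mat_sym: "edge_mat i a r p q = edge_mat i a r q p"
  by (simp add: edge_mat_def mult_ac)

lemma edge_mat_square: "edge_mat i a (a\<^sup>2) = (\<lambda>p q. edge_vec i a p * edge_vec i a q)"
  by (intro ext) (simp add: edge_mat_def edge_vec_def power2_eq_square)

lemma cut_affine_on_edge:
  assumes "cut_form n l"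
  obtains A B C where
    "\<And>a r. l (periodic_vec n (edge_vec i a)) (periodic_mat n (edge_mat i a r)) = A + B * a + C * r"
proof -
  define g where "g a r = l (periodic_vec n (edge_vec i a)) (periodic_mat n (edge_mat i a r))" for a r
  define a' r' :: "nat \<Rightarrow> real" where "a' k = (if k = 1 then 1 else 0)" and "r' k = (if k = 2 then 1 else 0)" for k
  \<comment> \<open>The pair \<open>(a, r)\<close> is an affine combination of \<open>(0, 0)\<close>, \<open>(1, 0)\<close> and \<open>(0, 1)\<close>.\<close>
  have "g a r = (1 - a - r) * g 0 0 + a * g 1 0 + r * g 0 1" for a r
  proof -
    define w :: "nat \<Rightarrow> real" where "w k = (if k = 0 then 1 - a - r else if k = 1 then a else r)" for k
    have K: "{..<3} = {0, 1, 2::nat}" by auto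
    have "edge_vec i a = (\<lambda>p. \<Sum>k<3. w k * edge_vec i (a' k) p)"
      by (intro ext) (auto simp: K w_def a'_def edge_vec_def)
    moreover have "edge_mat i a r = (\<lambda>p q. \<Sum>k<3. w k * edge_mat i (a' k) (r' k) p q)"
      by (intro ext) (auto simp: K w_def a'_def r'_def edge_mat_def edge_vec_def)
    ultimately have "g a r = (\<Sum>k<3. w k * g (a' k) (r' k))"
      using cut_signed_combination [OF assms, where K = "{..<3}" and w = w
          and y = "\<lambda>k. edge_vec i (a' k)" and Y = "\<lambda>k. edge_mat i (a' k) (r' k)"]
      by (simp add: g_def edge_mat_sym) (simp add: K w_def)
    then show ?thesis by (simp add: K w_def a'_def r'_def)
  qed
  then have "g a r = g 0 0 + (g 1 0 - g 0 0) * a + (g 0 1 - g 0 0) * r" for a r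
    by (simp add: algebra_simps)
  then show ?thesis
    using that unfolding g_def by blast
qed

text \<open>
  The pairs \<open>(a, r)\<close> with \<open>a\<^sup>2 \<le> r \<le> a\<close> are the pairs of first and second moments of distributions
  on \<open>[0, 1]\<close>, that is, the convex hull of the arc \<open>r = a\<^sup>2\<close>.  A minimum over \<open>r\<close> lies on the
  parabola or, for a negative slope, on the chord \<open>r = a\<close> between its end points.
\<close>

lemma affine_nonneg_above_parabola:
  fixes A B C :: real
  assumes parabola: "\<And>a. 0 \<le> a \<Longrightarrow> a \<le> 1 \<Longrightarrow> 0 \<le> A + B * a + C * a\<^sup>2"
    and "0 \<le> a" "a \<le> 1" "a\<^sup>2 \<le> r" "r \<le> a"
  shows "0 \<le> A + B * a + C * r"
proof (cases "0 \<le> C")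
  case True
  then have "C * a\<^sup>2 \<le> C * r" using assms by (intro mult_left_mono)
  then show ?thesis using parabola [OF assms(2,3)] by linarith
next
  case False
  then have "C * a \<le> C * r" using assms by (intro mult_left_mono_neg) auto
  moreover have "0 \<le> A" "0 \<le> A + B + C"
    using parabola [of 0] parabola [of 1] by simp_all
  then have "0 \<le> (1 - a) * A + a * (A + B + C)"
    using assms(2,3) by simp
  ultimately show ?thesis by (simp add: algebra_simps)
qed

section \<open>The pseudo-moments\<close>

definition apex :: "nat \<Rightarrow> real" where
  "apex p = (if odd p then 1 else 0)"

text \<open>
  On edges 0, 1, 2 the mean is the point where \<open>a - b + c - d - t\<close> vanishes.  On edge 3 it is
  lowered by \<open>\<rho> * (2 + t)\<close>: the function equals \<open>- (2 + t)\<close> at the apex, and only this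
  shift makes its pseudo-expectation zero.
\<close>

definition edge_mean :: "real \<Rightarrow> real \<Rightarrow> nat \<Rightarrow> real" where
  "edge_mean \<rho> t i =
     (if i = 0 \<or> i = 2 then t else if i = 1 then 1 - t else 1 - t - \<rho> * (2 + t))"

text \<open>
  The amount by which the variance on each edge falls below zero.  The mean product of
  \<open>a - b + c - d - t\<close> with the function 1 is zero by the choice of the means; requiring the same of
  its products with the four coordinates gives four linear equations, which these values solve.
\<close>

definition edge_deficit :: "real \<Rightarrow> real \<Rightarrow> nat \<Rightarrow> real" where
  "edge_deficit \<rho> t i =
     \<rho> * (2 + t) * (if i = 0 \<or> i = 2 then 1 else if i = 1 then 0 else t + \<rho> * (2 + t))"

text \<open>
  Four unit masses on the edges and a mass \<open>\<rho>\<close> at the apex, normalized to total mass 1.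
\<close>

definition pseudo_vec :: "real \<Rightarrow> real \<Rightarrow> nat \<Rightarrow> real" where
  "pseudo_vec \<rho> t p = (\<rho> * apex p + (\<Sum>i<4. edge_vec i (edge_mean \<rho> t i) p)) / (4 + \<rho>)"

definition pseudo_mat :: "real \<Rightarrow> real \<Rightarrow> nat \<Rightarrow> nat \<Rightarrow> real" where
  "pseudo_mat \<rho> t p q =
     (\<rho> * (apex p * apex q)
      + (\<Sum>i<4. edge_mat i (edge_mean \<rho> t i) ((edge_mean \<rho> t i)\<^sup>2 - edge_deficit \<rho> t i) p q)) / (4 + \<rho>)"

lemma pseudo_mat_sym: "pseudo_mat \<rho> t p q = pseudo_mat \<rho> t q p"
  unfolding pseudo_mat_def by (subst edge_mat_sym) (simp add: mult_ac)

lemma cut_on_pseudo_moment: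
  assumes "cut_form n l" "4 + \<rho> \<noteq> 0"
  shows "(4 + \<rho>) * l (periodic_vec n (pseudo_vec \<rho> t)) (periodic_mat n (pseudo_mat \<rho> t))
    = \<rho> * l (periodic_vec n apex) (periodic_mat n (\<lambda>p q. apex p * apex q))
      + (\<Sum>i<4. l (periodic_vec n (edge_vec i (edge_mean \<rho> t i)))
           (periodic_mat n (edge_mat i (edge_mean \<rho> t i) ((edge_mean \<rho> t i)\<^sup>2 - edge_deficit \<rho> t i))))"
proof -
  define y where "y k = (if k < 4 then edge_vec k (edge_mean \<rho> t k) else apex)" for k
  define Y where "Y k = (if k < 4
    then edge_mat k (edge_mean \<rho> t k) ((edge_mean \<rho> t k)\<^sup>2 - edge_deficit \<rho> t k)
    else (\<lambda>p q. apex p * apex q))" for k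
  define w where "w k = (if k < 4 then 1 else \<rho>) / (4 + \<rho>)" for k :: nat
  have split: "(\<Sum>k<5. f k) = (\<Sum>k<4. f k) + f (4::nat)" for f :: "nat \<Rightarrow> real"
    by (simp add: eval_nat_numeral)
  have "l (periodic_vec n (\<lambda>p. \<Sum>k<5. w k * y k p)) (periodic_mat n (\<lambda>p q. \<Sum>k<5. w k * Y k p q))
       = (\<Sum>k<5. w k * l (periodic_vec n (y k)) (periodic_mat n (Y k)))"
  proof (rule cut_signed_combination [OF assms(1)])
    show "(\<Sum>k<5. w k) = 1"
      using assms(2) by (simp add: split w_def flip: add_divide_distrib)
    show "Y k p q = Y k q p" for k p q
      using edge_mat_sym by (auto simp: Y_def mult_ac)
  qed
  moreover have "pseudo_vec \<rho> t = (\<lambda>p. \<Sum>k<5. w k * y k p)"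
    by (intro ext) (simp add: pseudo_vec_def split w_def y_def add_divide_distrib sum_divide_distrib)
  moreover have "pseudo_mat \<rho> t = (\<lambda>p q. \<Sum>k<5. w k * Y k p q)"
    by (intro ext) (simp add: pseudo_mat_def split w_def Y_def add_divide_distrib sum_divide_distrib)
  ultimately show ?thesis
    using assms(2)
    by (simp add: split w_def y_def Y_def flip: sum_divide_distrib add_divide_distrib)
qed

text \<open>
  On each edge, averaging the parameters \<open>s\<close> and \<open>t\<close> adds the variance \<open>(a - b)\<^sup>2 / 4\<close> of two
  means \<open>a\<close>, \<open>b\<close>.  It outweighs both deficits, which are at most \<open>3 * \<rho>\<close>, and the averaged
  pseudo-moment is therefore a mixture of point masses in the cube, where the cut is nonnegative.
\<close>

lemma cut_cannot_violate_two_pseudo_moments: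
  assumes cut: "valid_cut n l" and \<rho>: "0 \<le> \<rho>" "\<rho> \<le> 1 / 1000000"
    and s: "1 / 2 \<le> s" "s \<le> 3 / 4" and t: "1 / 2 \<le> t" "t \<le> 3 / 4"
    and far: "12 * \<rho> \<le> (s - t)\<^sup>2"
    and viol_s: "l (periodic_vec n (pseudo_vec \<rho> s)) (periodic_mat n (pseudo_mat \<rho> s)) < 0"
    and viol_t: "l (periodic_vec n (pseudo_vec \<rho> t)) (periodic_mat n (pseudo_mat \<rho> t)) < 0"
  shows False
proof -
  define g where "g i a r = l (periodic_vec n (edge_vec i a)) (periodic_mat n (edge_mat i a r))" for i a r
  have form: "cut_form n l" using cut by (simp add: valid_cut_def)
  have edge: "0 \<le> g i (edge_mean \<rho> s i) ((edge_mean \<rho> s i)\<^sup>2 - edge_deficit \<rho> s i)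
      + g i (edge_mean \<rho> t i) ((edge_mean \<rho> t i)\<^sup>2 - edge_deficit \<rho> t i)" if "i < 4" for i
  proof -
    obtain A B C where g: "\<And>a r. g i a r = A + B * a + C * r"
      using cut_affine_on_edge [OF form] unfolding g_def by metis
    have parabola: "0 \<le> A + B * a + C * a\<^sup>2" if "0 \<le> a" "a \<le> 1" for a
    proof -
      have "0 \<le> edge_vec i a p \<and> edge_vec i a p \<le> 1" for p
        using that by (simp add: edge_vec_def)
      then have "0 \<le> g i a (a\<^sup>2)"
        unfolding g_def edge_mat_square by (rule valid_cut_nonneg [OF cut])
      then show ?thesis by (simp only: g)
    qed
    define a b where "a = edge_mean \<rho> s i" and "b = edge_mean \<rho> t i"
    define u v where "u = edge_deficit \<rho> s i" and "v = edge_deficit \<rho> t i"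
    define \<delta> \<epsilon> where "\<delta> = \<rho> * (2 + s)" and "\<epsilon> = \<rho> * (2 + t)"
    have shift: "0 \<le> \<delta>" "\<delta> \<le> 3 * \<rho>" "0 \<le> \<epsilon>" "\<epsilon> \<le> 3 * \<rho>"
      using \<rho> s t mult_left_mono [of "2 + s" 3 \<rho>] mult_left_mono [of "2 + t" 3 \<rho>]
      by (auto simp: \<delta>_def \<epsilon>_def)
    have box: "0 \<le> a" "a \<le> 1" "0 \<le> b" "b \<le> 1"
      using shift s t \<rho> by (auto simp: a_def b_def edge_mean_def simp flip: \<delta>_def \<epsilon>_def)
    have u: "0 \<le> u" "u \<le> 3 * \<rho>"
      using shift s \<rho> mult_left_mono [of "s + \<delta>" 1 \<delta>]
      by (auto simp: u_def edge_deficit_def simp flip: \<delta>_def)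
    have v: "0 \<le> v" "v \<le> 3 * \<rho>"
      using shift t \<rho> mult_left_mono [of "t + \<epsilon>" 1 \<epsilon>]
      by (auto simp: v_def edge_deficit_def simp flip: \<epsilon>_def)
    have "\<bar>s - t\<bar> \<le> \<bar>a - b\<bar>"
    proof -
      \<comment> \<open>Edges 0 and 2, edge 3, and edge 1, respectively.\<close>
      have "a - b = s - t \<or> a - b = (1 + \<rho>) * (t - s) \<or> a - b = t - s"
        by (auto simp: a_def b_def edge_mean_def algebra_simps)
      moreover have "\<bar>s - t\<bar> \<le> \<bar>(1 + \<rho>) * (t - s)\<bar>"
        using \<rho> mult_right_mono [of 1 "1 + \<rho>" "\<bar>t - s\<bar>"] by (simp add: abs_mult abs_minus_commute)
      ultimately show ?thesis by (auto simp: abs_minus_commute)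
    qed
    then have "(s - t)\<^sup>2 \<le> (a - b)\<^sup>2" by (simp add: abs_le_square_iff)
    then have gap: "2 * u + 2 * v \<le> (a - b)\<^sup>2" using u v far by linarith
    have "0 \<le> A + B * ((a + b) / 2) + C * ((a\<^sup>2 - u + (b\<^sup>2 - v)) / 2)"
    proof (rule affine_nonneg_above_parabola [OF parabola])
      show "((a + b) / 2)\<^sup>2 \<le> (a\<^sup>2 - u + (b\<^sup>2 - v)) / 2"
        using gap by (simp add: power2_eq_square field_simps)
      have "a\<^sup>2 \<le> a" "b\<^sup>2 \<le> b"
        using box mult_left_mono [of a 1 a] mult_left_mono [of b 1 b] by (auto simp: power2_eq_square)
      then show "(a\<^sup>2 - u + (b\<^sup>2 - v)) / 2 \<le> (a + b) / 2" using u v by simp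
    qed (use box in auto)
    then show ?thesis
      by (simp add: g flip: a_def b_def u_def v_def) (simp add: field_simps)
  qed
  have ap: "0 \<le> l (periodic_vec n apex) (periodic_mat n (\<lambda>p q. apex p * apex q))"
    by (rule valid_cut_nonneg [OF cut]) (simp add: apex_def)
  have "0 \<le> 2 * (\<rho> * l (periodic_vec n apex) (periodic_mat n (\<lambda>p q. apex p * apex q)))
     + (\<Sum>i<4. g i (edge_mean \<rho> s i) ((edge_mean \<rho> s i)\<^sup>2 - edge_deficit \<rho> s i)
             + g i (edge_mean \<rho> t i) ((edge_mean \<rho> t i)\<^sup>2 - edge_deficit \<rho> t i))"
    using ap \<rho> by (intro add_nonneg_nonneg sum_nonneg edge) auto
  also have "\<dots> = (4 + \<rho>) * l (periodic_vec n (pseudo_vec \<rho> s)) (periodic_mat n (pseudo_mat \<rho> s))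
      + (4 + \<rho>) * l (periodic_vec n (pseudo_vec \<rho> t)) (periodic_mat n (pseudo_mat \<rho> t))"
    using \<rho> by (subst (1 2) cut_on_pseudo_moment [OF form]) (auto simp: g_def sum.distrib)
  also have "\<dots> < 0"
    using viol_s viol_t \<rho> by (intro add_neg_neg mult_pos_neg) auto
  finally show False by simp
qed

text \<open>
  This is \<open>4 + \<rho>\<close> times the quadratic form of the pseudo-moment.  The vector
  \<open>(- t, 1, - 1, 1, - 1)\<close> is in its kernel.  Modulo this vector one may take \<open>v0 = 0\<close>, and then
  the four squares coming from the edges form a triangular, hence positive definite, system
  in the remaining variables.  It dominates the negative terms as these have order \<open>\<rho>\<close>.
\<close>

lemma pseudo_form_nonneg:
  fixes \<rho> t v0 V0 V1 V2 V3 :: real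
  assumes \<rho>: "0 \<le> \<rho>" "\<rho> \<le> 1 / 1000000" and t: "1 / 2 \<le> t" "t \<le> 3 / 4"
    and \<delta>: "\<delta> = \<rho> * (2 + t)"
  shows "0 \<le> \<rho> * (v0 + V1 + V3)\<^sup>2 + (v0 + t * V0)\<^sup>2 + (v0 + V0 + (1 - t) * V1)\<^sup>2
      + (v0 + V0 + V1 + t * V2)\<^sup>2 + (v0 + V0 + V1 + V2 + (1 - t - \<delta>) * V3)\<^sup>2
      - \<delta> * V0\<^sup>2 - \<delta> * V2\<^sup>2 - \<delta> * (t + \<delta>) * V3\<^sup>2" (is "0 \<le> ?F")
proof -
  \<comment> \<open>Adding \<open>c\<close> times the kernel vector removes \<open>v0\<close>; the \<open>U\<close> are the new coordinates.\<close>
  define c where "c = v0 / t"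
  define U0 U1 U2 U3 where "U0 = V0 + c" and "U1 = V1 - c" and "U2 = V2 + c" and "U3 = V3 - c"
  define z0 z1 z2 z3 where "z0 = t * U0" and "z1 = U0 + (1 - t) * U1"
    and "z2 = U0 + U1 + t * U2" and "z3 = U0 + U1 + U2 + (1 - t - \<delta>) * U3"
  define S where "S = z0\<^sup>2 + z1\<^sup>2 + z2\<^sup>2 + z3\<^sup>2"
  have v0: "v0 = t * c" using t by (simp add: c_def)
  have V: "V0 = U0 - c" "V1 = U1 + c" "V2 = U2 - c" "V3 = U3 + c"
    by (simp_all add: U0_def U1_def U2_def U3_def)
  have F: "?F = \<rho> * (U1 + U3)\<^sup>2 + S - \<delta> * U0\<^sup>2 - \<delta> * U2\<^sup>2 - \<delta> * (t + \<delta>) * U3\<^sup>2"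
  proof -
    have "\<rho> * (v0 + V1 + V3)\<^sup>2 = \<rho> * (U1 + U3)\<^sup>2 + 2 * \<delta> * c * (U1 + U3) + \<delta> * (2 + t) * c\<^sup>2"
      unfolding v0 V \<delta> by (simp add: power2_eq_square algebra_simps)
    moreover have "v0 + t * V0 = z0" "v0 + V0 + (1 - t) * V1 = z1" "v0 + V0 + V1 + t * V2 = z2"
      "v0 + V0 + V1 + V2 + (1 - t - \<delta>) * V3 = z3 - \<delta> * c"
      unfolding z0_def z1_def z2_def z3_def v0 V by (simp_all add: algebra_simps)
    ultimately have "?F = \<rho> * (U1 + U3)\<^sup>2 + 2 * \<delta> * c * (U1 + U3) + \<delta> * (2 + t) * c\<^sup>2
        + z0\<^sup>2 + z1\<^sup>2 + z2\<^sup>2 + (z3 - \<delta> * c)\<^sup>2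
        - \<delta> * (U0 - c)\<^sup>2 - \<delta> * (U2 - c)\<^sup>2 - \<delta> * (t + \<delta>) * (U3 + c)\<^sup>2"
      by (simp only: V)
    also have "\<dots> = \<rho> * (U1 + U3)\<^sup>2 + S - \<delta> * U0\<^sup>2 - \<delta> * U2\<^sup>2 - \<delta> * (t + \<delta>) * U3\<^sup>2"
      unfolding S_def z3_def by (simp add: power2_eq_square algebra_simps)
    finally show ?thesis .
  qed
  have \<delta>': "0 \<le> \<delta>" "\<delta> \<le> 3 / 1000000"
    using \<rho> t mult_mono [of \<rho> "1 / 1000000" "2 + t" 3] by (auto simp: \<delta>)
  \<comment> \<open>Forward substitution bounds each coordinate by a multiple of the sum of squares \<open>S\<close>.\<close>
  have two: "(x + y)\<^sup>2 \<le> 2 * (x\<^sup>2 + y\<^sup>2)" for x y :: real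
    using sum_squares_bound [of x y] by (simp add: power2_eq_square algebra_simps)
  have scale: "x\<^sup>2 \<le> k\<^sup>2 * (m * x)\<^sup>2" if "1 \<le> k * m" for x k m :: real
  proof -
    have "1 \<le> (k * m)\<^sup>2" using that by (simp add: one_le_power)
    then have "1 * x\<^sup>2 \<le> (k * m)\<^sup>2 * x\<^sup>2" by (rule mult_right_mono) simp
    then show ?thesis by (simp add: power_mult_distrib mult_ac)
  qed
  have zS: "z0\<^sup>2 \<le> S" "z1\<^sup>2 \<le> S" "z2\<^sup>2 \<le> S" "z3\<^sup>2 \<le> S" by (simp_all add: S_def)
  have S: "0 \<le> S" by (simp add: S_def)
  have "U0\<^sup>2 \<le> 4 * z0\<^sup>2"
    using scale [of 2 t U0] t by (simp add: z0_def)
  then have U0: "U0\<^sup>2 \<le> 4 * S" using zS by linarith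
  have "U1\<^sup>2 \<le> 16 * ((1 - t) * U1)\<^sup>2"
    using scale [of 4 "1 - t" U1] t by simp
  moreover have "(1 - t) * U1 = z1 + (- U0)" by (simp add: z1_def)
  ultimately have U1: "U1\<^sup>2 \<le> 160 * S"
    using two [of z1 "- U0"] U0 zS by simp
  have "U2\<^sup>2 \<le> 4 * (t * U2)\<^sup>2"
    using scale [of 2 t U2] t by simp
  moreover have "t * U2 = z2 + (- (U0 + U1))" by (simp add: z2_def)
  ultimately have "U2\<^sup>2 \<le> 8 * z2\<^sup>2 + 16 * U0\<^sup>2 + 16 * U1\<^sup>2"
    using two [of z2 "- (U0 + U1)"] two [of U0 U1] unfolding power2_minus by simp
  then have U2: "U2\<^sup>2 \<le> 2640 * S" using U0 U1 zS S by linarith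
  have "U3\<^sup>2 \<le> 25 * ((1 - t - \<delta>) * U3)\<^sup>2"
    using scale [of 5 "1 - t - \<delta>" U3] t \<delta>' by simp
  moreover define w where "w = U0 + U1 + U2"
  then have "(1 - t - \<delta>) * U3 = z3 + (- w)" by (simp add: z3_def)
  ultimately have "U3\<^sup>2 \<le> 50 * z3\<^sup>2 + 50 * w\<^sup>2"
    using two [of z3 "- w"] by simp
  moreover have "w\<^sup>2 \<le> 2 * U2\<^sup>2 + 4 * U0\<^sup>2 + 4 * U1\<^sup>2"
    using two [of "U0 + U1" U2] two [of U0 U1] by (simp add: w_def)
  ultimately have U3: "U3\<^sup>2 \<le> 320000 * S" using U0 U1 U2 zS S by linarith
  have "\<delta> * U0\<^sup>2 + \<delta> * U2\<^sup>2 + \<delta> * (t + \<delta>) * U3\<^sup>2 \<le> \<delta> * U0\<^sup>2 + \<delta> * U2\<^sup>2 + \<delta> * 1 * U3\<^sup>2"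
    using t \<delta>' by (intro add_left_mono mult_right_mono mult_left_mono) auto
  also have "\<dots> = \<delta> * (U0\<^sup>2 + U2\<^sup>2 + U3\<^sup>2)" by (simp add: algebra_simps)
  also have "\<dots> \<le> 3 / 1000000 * (U0\<^sup>2 + U2\<^sup>2 + U3\<^sup>2)"
    using \<delta>' by (intro mult_right_mono) auto
  also have "\<dots> \<le> 3 / 1000000 * (322644 * S)"
    using U0 U2 U3 by (intro mult_left_mono) auto
  also have "\<dots> \<le> S" using S by simp
  finally have "\<delta> * U0\<^sup>2 + \<delta> * U2\<^sup>2 + \<delta> * (t + \<delta>) * U3\<^sup>2 \<le> S" .
  moreover have "0 \<le> \<rho> * (U1 + U3)\<^sup>2" using \<rho> by simp
  ultimately show ?thesis unfolding F by linarith
qed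

lemmas pseudo_unfold = pseudo_vec_def pseudo_mat_def edge_vec_def edge_mat_def
  edge_mean_def edge_deficit_def apex_def sum_lessThan_4

text \<open>
  Clearing the denominator and listing the entries reduces the claim to the preceding form.
\<close>

lemma pseudo_moment_in_shor_set:
  assumes \<rho>: "0 \<le> \<rho>" "\<rho> \<le> 1 / 1000000" and t: "1 / 2 \<le> t" "t \<le> 3 / 4"
  shows "(periodic_vec n (pseudo_vec \<rho> t), periodic_mat n (pseudo_mat \<rho> t)) \<in> shor_set n"
proof (rule periodic_in_shor_set [OF pseudo_mat_sym])
  fix v0 :: real and V :: "nat \<Rightarrow> real"
  define \<delta> where "\<delta> = \<rho> * (2 + t)"
  define y Y where "y p = (4 + \<rho>) * pseudo_vec \<rho> t p" and "Y p q = (4 + \<rho>) * pseudo_mat \<rho> t p q" for p q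
  have y: "y 0 = 3 + t" "y 1 = \<rho> + 3 - t" "y 2 = 1 + t" "y 3 = \<rho> + 1 - t - \<delta>"
    using \<rho> by (simp_all add: y_def pseudo_unfold \<delta>_def)
  have Y: "Y 0 0 = 3 + t\<^sup>2 - \<delta>" "Y 1 1 = \<rho> + 2 + (1 - t)\<^sup>2" "Y 2 2 = 1 + t\<^sup>2 - \<delta>"
      "Y 3 3 = \<rho> + (1 - t - \<delta>)\<^sup>2 - \<delta> * (t + \<delta>)"
      "Y 0 1 = 3 - t" "Y 1 0 = 3 - t" "Y 0 2 = 1 + t" "Y 2 0 = 1 + t"
      "Y 0 3 = 1 - t - \<delta>" "Y 3 0 = 1 - t - \<delta>"
      "Y 1 2 = 1 + t" "Y 2 1 = 1 + t" "Y 1 3 = \<rho> + 1 - t - \<delta>" "Y 3 1 = \<rho> + 1 - t - \<delta>"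
      "Y 2 3 = 1 - t - \<delta>" "Y 3 2 = 1 - t - \<delta>"
    using \<rho> by (simp_all add: Y_def pseudo_unfold \<delta>_def)
  have "0 \<le> (4 + \<rho>) * v0\<^sup>2 + 2 * v0 * (\<Sum>p<4. y p * V p) + (\<Sum>p<4. \<Sum>q<4. Y p q * V q * V p)"
    using pseudo_form_nonneg [OF \<rho> t \<delta>_def, of v0 "V 1" "V 3" "V 0" "V 2"]
    unfolding sum_lessThan_4 y Y by (simp add: power2_eq_square algebra_simps)
  also have "\<dots> = (4 + \<rho>) * (v0\<^sup>2 + 2 * v0 * (\<Sum>p<4. pseudo_vec \<rho> t p * V p)
      + (\<Sum>p<4. \<Sum>q<4. pseudo_mat \<rho> t p q * V q * V p))"
    by (simp add: y_def Y_def distrib_left sum_distrib_left mult_ac)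
  finally show "0 \<le> v0\<^sup>2 + 2 * v0 * (\<Sum>p<4. pseudo_vec \<rho> t p * V p)
      + (\<Sum>p<4. \<Sum>q<4. pseudo_mat \<rho> t p q * V q * V p)"
    using \<rho> by (simp add: zero_le_mult_iff)
qed

section \<open>The instances\<close>

text \<open>
  The quadratic \<open>(q_t - t\<^sup>2) / 4\<close> on one block: \<open>q_t\<close> without its constant term, scaled
  so that all coefficients have absolute value at most 1.
\<close>

definition block_Q :: "nat \<Rightarrow> nat \<Rightarrow> real" where
  "block_Q p q = (if p = q then 1 / 4 else if p = Suc q \<or> q = Suc p then - 1 / 4
     else if p + q = 3 then - 1 / 8 else 0)"

definition block_c :: "real \<Rightarrow> nat \<Rightarrow> real" where
  "block_c t p = (if p = 0 then - t / 2 else if p = 1 then t / 2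
     else if p = 2 then (1 - t) / 2 else (2 * t + 1) / 4)"

definition block_objective :: "real \<Rightarrow> (nat \<Rightarrow> real) \<Rightarrow> (nat \<Rightarrow> nat \<Rightarrow> real) \<Rightarrow> real" where
  "block_objective t y Y = (\<Sum>p<4. \<Sum>q<4. block_Q p q * Y p q) + (\<Sum>p<4. block_c t p * y p)"

lemma block_objective_expand:
  assumes "\<And>p q. p < 4 \<Longrightarrow> q < 4 \<Longrightarrow> Y p q = Y q p"
  shows "4 * block_objective t y Y = Y 0 0 + Y 1 1 + Y 2 2 + Y 3 3 - 2 * Y 0 1 - 2 * Y 1 2 - 2 * Y 2 3
     - Y 0 3 - 2 * t * y 0 + 2 * t * y 1 + (2 - 2 * t) * y 2 + (2 * t + 1) * y 3"
proof -
  have "Y 1 0 = Y 0 1" "Y 2 1 = Y 1 2" "Y 3 2 = Y 2 3" "Y 3 0 = Y 0 3"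
    by (auto intro: assms)
  then show ?thesis
    by (simp add: block_objective_def sum_lessThan_4 block_Q_def block_c_def)
qed

text \<open>
  Nonnegativity of \<open>q_t\<close> on the cube.  If \<open>1 - y 1\<close> and \<open>y 2\<close> sum to at least one
  half, the two positive products dominate the negative one.  Otherwise \<open>y 0 - y 1 + y 2 - y 3 - t\<close> is so
  negative that its square alone does.
\<close>

lemma block_objective_box:
  assumes box: "\<And>p. p < 4 \<Longrightarrow> 0 \<le> y p \<and> y p \<le> 1" and t: "1 / 2 \<le> t"
  shows "- t\<^sup>2 / 4 \<le> block_objective t y (\<lambda>p q. y p * y q)"
proof -
  \<comment> \<open>Complementing the first two coordinates makes all products have nonnegative factors.\<close>
  define a b c d where "a = 1 - y 0" and "b = 1 - y 1" and "c = y 2" and "d = y 3"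
  have ab: "0 \<le> a" "a \<le> 1" "0 \<le> b" "0 \<le> c" "0 \<le> d" "d \<le> 1"
    using box [of 0] box [of 1] box [of 2] box [of 3] by (auto simp: a_def b_def c_def d_def)
  have y: "y 0 = 1 - a" "y 1 = 1 - b" "y 2 = c" "y 3 = d"
    by (simp_all add: a_def b_def c_def d_def)
  have "0 \<le> (b + c - a - d - t)\<^sup>2 + 2 * c * a + 2 * d * b - d * a"
  proof (cases "1 / 2 \<le> b + c")
    case True
    have "a * d \<le> a" "d * a \<le> d" using ab by (auto intro: mult_left_le)
    then have "c * (a * d) \<le> c * a" "b * (d * a) \<le> b * d"
      using ab by (auto intro!: mult_left_mono)
    moreover have "1 / 2 * (a * d) \<le> (b + c) * (a * d)"
      using True ab by (intro mult_right_mono) auto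
    ultimately have "d * a \<le> 2 * c * a + 2 * d * b" by (simp add: algebra_simps)
    then show ?thesis using zero_le_power2 [of "b + c - a - d - t"] by linarith
  next
    case False
    then have "(a + d)\<^sup>2 \<le> (a + d + t - b - c)\<^sup>2" using ab t by (intro power_mono) auto
    also have "\<dots> = (b + c - a - d - t)\<^sup>2" by (simp add: power2_eq_square algebra_simps)
    finally have "(a + d)\<^sup>2 \<le> (b + c - a - d - t)\<^sup>2" .
    moreover have "d * a \<le> (a + d)\<^sup>2"
      using ab by (simp add: power2_eq_square algebra_simps)
    moreover have "0 \<le> c * a" "0 \<le> d * b" using ab by auto
    ultimately show ?thesis by simp
  qed
  also have "\<dots> = t\<^sup>2 + 4 * block_objective t y (\<lambda>p q. y p * y q)"
    unfolding block_objective_expand [of "\<lambda>p q. y p * y q", OF mult.commute] y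
    by (simp add: power2_eq_square algebra_simps)
  finally show ?thesis by simp
qed

text \<open>
  The square has pseudo-expectation zero since its root is in the kernel of the moment matrix, and
  both positive products vanish on the edges and at the apex.  What remains is \<open>- d(1-a)\<close>, which
  only the mass \<open>\<rho>\<close> at the apex sees.
\<close>

lemma block_objective_pseudo:
  assumes "0 \<le> \<rho>"
  shows "block_objective t (pseudo_vec \<rho> t) (pseudo_mat \<rho> t) = - t\<^sup>2 / 4 - \<rho> / (4 * (4 + \<rho>))"
proof -
  have "4 * (4 + \<rho>) * block_objective t (pseudo_vec \<rho> t) (pseudo_mat \<rho> t) = - (4 + \<rho>) * t\<^sup>2 - \<rho>"
  proof -
    define y Y where "y p = (4 + \<rho>) * pseudo_vec \<rho> t p" and "Y p q = (4 + \<rho>) * pseudo_mat \<rho> t p q" for p q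
    have Y_sym: "Y p q = Y q p" for p q
      unfolding Y_def by (subst pseudo_mat_sym) (rule refl)
    have "4 * (4 + \<rho>) * block_objective t (pseudo_vec \<rho> t) (pseudo_mat \<rho> t) = 4 * block_objective t y Y"
      by (simp add: block_objective_def y_def Y_def distrib_left sum_distrib_left mult_ac)
    also have "\<dots> = - (4 + \<rho>) * t\<^sup>2 - \<rho>"
      unfolding block_objective_expand [of Y, OF Y_sym]
      using assms by (simp add: y_def Y_def pseudo_unfold) (simp add: power2_eq_square algebra_simps)
    finally show ?thesis .
  qed
  then show ?thesis using assms by (simp add: field_simps)
qed

text \<open>
  Copies of the block objective on the \<open>n div 4\<close> complete blocks of four consecutive coordinates.
  The at most three remaining coordinates do not enter the objective.
\<close>

definition instance_Q :: "nat \<Rightarrow> real mat" where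
  "instance_Q n = mat n n (\<lambda>(i, j).
     if i div 4 = j div 4 \<and> i div 4 < n div 4 then block_Q (i mod 4) (j mod 4) else 0)"

definition instance_c :: "nat \<Rightarrow> real \<Rightarrow> real vec" where
  "instance_c n t = vec n (\<lambda>i. if i div 4 < n div 4 then block_c t (i mod 4) else 0)"

lemma instance_normalized:
  assumes "0 \<le> t" "t \<le> 1"
  shows "(instance_Q n, instance_c n t) \<in> normalized_instances n"
proof -
  have "block_Q p q = block_Q q p" "\<bar>block_Q p q\<bar> \<le> 1" "\<bar>block_c t p\<bar> \<le> 1" for p q
    using assms by (auto simp: block_Q_def block_c_def)
  moreover have "block_Q (i mod 4) (j mod 4) \<le> 0" if "i \<noteq> j" "i div 4 = j div 4" for i j
  proof -
    have "i mod 4 \<noteq> j mod 4" using that by (metis div_mult_mod_eq)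
    then show ?thesis by (simp add: block_Q_def)
  qed
  ultimately show ?thesis
    by (auto simp: normalized_instances_def sym_mats_def instance_Q_def instance_c_def)
qed

lemma sum_one_block:
  fixes f :: "nat \<Rightarrow> real"
  assumes "k < n div 4"
  shows "(\<Sum>j<n. if k = j div 4 then f j else 0) = (\<Sum>p<4. f (4 * k + p))"
proof -
  have "(\<Sum>j<n. if k = j div 4 then f j else 0) = (\<Sum>j\<in>{..<n} \<inter> {j. k = j div 4}. f j)"
    by (simp add: sum.inter_restrict)
  also have "{..<n} \<inter> {j. k = j div 4} = (\<lambda>p. 4 * k + p) ` {..<4}"
  proof -
    have "j \<in> (\<lambda>p. 4 * k + p) ` {..<4}" if "k = j div 4" for j
      using that by (intro image_eqI [of _ _ "j mod 4"]) auto
    then show ?thesis using assms by auto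
  qed
  also have "(\<Sum>j\<in>(\<lambda>p. 4 * k + p) ` {..<4}. f j) = (\<Sum>p<4. f (4 * k + p))"
    by (subst sum.reindex) (auto simp: inj_on_def)
  finally show ?thesis .
qed

lemma sum_all_blocks:
  fixes f :: "nat \<Rightarrow> real"
  shows "(\<Sum>i<n. if i div 4 < n div 4 then f i else 0) = (\<Sum>k<n div 4. \<Sum>p<4. f (4 * k + p))"
proof -
  have "(\<Sum>i<n. if i div 4 < n div 4 then f i else 0)
      = (\<Sum>i<n. \<Sum>k<n div 4. if k = i div 4 then f i else 0)"
    by (intro sum.cong) auto
  also have "\<dots> = (\<Sum>k<n div 4. \<Sum>i<n. if k = i div 4 then f i else 0)"
    by (rule sum.swap)
  also have "\<dots> = (\<Sum>k<n div 4. \<Sum>p<4. f (4 * k + p))"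
    by (rule sum.cong [OF refl]) (simp add: sum_one_block)
  finally show ?thesis .
qed

lemma instance_objective:
  assumes "x \<in> carrier_vec n"
  shows "frobenius_prod n (instance_Q n) X + instance_c n t \<bullet> x
    = (\<Sum>k<n div 4. block_objective t (\<lambda>p. x $ (4 * k + p)) (\<lambda>p q. X $$ (4 * k + p, 4 * k + q)))"
proof -
  have "frobenius_prod n (instance_Q n) X
      = (\<Sum>i<n. if i div 4 < n div 4
           then \<Sum>j<n. if i div 4 = j div 4 then block_Q (i mod 4) (j mod 4) * X $$ (i, j) else 0 else 0)"
    unfolding frobenius_prod_def by (intro sum.cong) (auto simp: instance_Q_def intro!: sum.cong sum.neutral)
  also have "\<dots> = (\<Sum>k<n div 4. \<Sum>p<4. \<Sum>q<4. block_Q p q * X $$ (4 * k + p, 4 * k + q))"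
    unfolding sum_all_blocks by (rule sum.cong [OF refl]) (simp add: sum_one_block)
  finally have Q: "frobenius_prod n (instance_Q n) X
      = (\<Sum>k<n div 4. \<Sum>p<4. \<Sum>q<4. block_Q p q * X $$ (4 * k + p, 4 * k + q))" .
  have "instance_c n t \<bullet> x = (\<Sum>i<n. if i div 4 < n div 4 then block_c t (i mod 4) * x $ i else 0)"
    using assms by (auto simp: scalar_prod_def instance_c_def atLeast0LessThan intro!: sum.cong)
  also have "\<dots> = (\<Sum>k<n div 4. \<Sum>p<4. block_c t p * x $ (4 * k + p))"
    unfolding sum_all_blocks by (rule sum.cong [OF refl]) simp
  finally show ?thesis by (simp add: Q block_objective_def sum.distrib)
qed

lemma quadratic_form_as_frobenius:
  assumes "x \<in> carrier_vec n" "Q \<in> carrier_mat n n"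
  shows "x \<bullet> (Q *\<^sub>v x) = frobenius_prod n Q (outer_square x)"
  using assms
  by (auto simp: frobenius_prod_def outer_square_def scalar_prod_def atLeast0LessThan
      sum_distrib_left mult_ac intro!: sum.cong)

lemma instance_bcqp_value:
  assumes "1 / 2 \<le> t"
  shows "ereal (real (n div 4) * (- t\<^sup>2 / 4)) \<le> bcqp_value n (instance_Q n) (instance_c n t)"
  unfolding bcqp_value_def
proof (rule INF_greatest)
  fix x assume x: "x \<in> unit_box n"
  then have xc: "x \<in> carrier_vec n" by (simp add: unit_box_def)
  have "real (n div 4) * (- t\<^sup>2 / 4) = (\<Sum>k<n div 4. - t\<^sup>2 / 4)" by simp
  also have "\<dots> \<le> (\<Sum>k<n div 4. block_objective t (\<lambda>p. x $ (4 * k + p))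
      (\<lambda>p q. x $ (4 * k + p) * x $ (4 * k + q)))"
  proof (intro sum_mono block_objective_box)
    fix k p :: nat assume "k \<in> {..<n div 4}" "p < 4"
    then have "4 * k + p < n" by auto
    then show "0 \<le> x $ (4 * k + p) \<and> x $ (4 * k + p) \<le> 1" using x by (simp add: unit_box_def)
  qed (use assms in auto)
  also have "\<dots> = (\<Sum>k<n div 4. block_objective t (\<lambda>p. x $ (4 * k + p))
      (\<lambda>p q. outer_square x $$ (4 * k + p, 4 * k + q)))"
    using xc by (auto simp: block_objective_def outer_square_def intro!: sum.cong)
  also have "\<dots> = x \<bullet> (instance_Q n *\<^sub>v x) + instance_c n t \<bullet> x"
    by (simp add: instance_objective [OF xc, symmetric] quadratic_form_as_frobenius [OF xc] instance_Q_def)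
  finally show "ereal (real (n div 4) * (- t\<^sup>2 / 4))
      \<le> ereal (x \<bullet> (instance_Q n *\<^sub>v x) + instance_c n t \<bullet> x)" by simp
qed

lemma instance_gap:
  assumes \<rho>: "0 \<le> \<rho>" "\<rho> \<le> 1 / 1000000" and t: "1 / 2 \<le> t" "t \<le> 3 / 4"
    and cuts: "\<And>i. i < m \<Longrightarrow>
      0 \<le> l i (periodic_vec n (pseudo_vec \<rho> t)) (periodic_mat n (pseudo_mat \<rho> t))"
  shows "ereal (real (n div 4) * (\<rho> / (4 * (4 + \<rho>)))) \<le> relaxation_gap n m l (instance_Q n) (instance_c n t)"
proof -
  let ?x = "periodic_vec n (pseudo_vec \<rho> t)" and ?X = "periodic_mat n (pseudo_mat \<rho> t)"
  have "(?x, ?X) \<in> sdp_feasible n m l"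
    using cuts pseudo_moment_in_shor_set [OF \<rho> t] by (simp add: sdp_feasible_def)
  then have "sdp_value n m l (instance_Q n) (instance_c n t)
      \<le> ereal (frobenius_prod n (instance_Q n) ?X + instance_c n t \<bullet> ?x)"
    unfolding sdp_value_def by (rule INF_lower2) simp
  also have "frobenius_prod n (instance_Q n) ?X + instance_c n t \<bullet> ?x
      = (\<Sum>k<n div 4. block_objective t (pseudo_vec \<rho> t) (pseudo_mat \<rho> t))"
    unfolding instance_objective [OF periodic_vec_simps(1)]
    by (auto simp: block_objective_def intro!: sum.cong arg_cong2 [of _ _ _ _ "(+)"])
  also have "\<dots> = real (n div 4) * (- t\<^sup>2 / 4 - \<rho> / (4 * (4 + \<rho>)))"
    by (simp add: block_objective_pseudo [OF \<rho>(1)])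
  finally have "ereal (real (n div 4) * (- t\<^sup>2 / 4)) - ereal (real (n div 4) * (- t\<^sup>2 / 4 - \<rho> / (4 * (4 + \<rho>))))
      \<le> relaxation_gap n m l (instance_Q n) (instance_c n t)"
    unfolding relaxation_gap_def by (intro ereal_minus_mono instance_bcqp_value t)
  then show ?thesis by (simp add: algebra_simps)
qed

section \<open>Counting the violated pseudo-moments\<close>

text \<open>
  If each of the \<open>m + 1\<close> equally spaced parameters were excluded by some cut, two of them would
  share a cut.
\<close>

lemma unviolated_pseudo_moment:
  assumes cuts: "\<And>i. i < m \<Longrightarrow> valid_cut n (l i)"
    and \<rho>: "0 \<le> \<rho>" "\<rho> \<le> 1 / 1000000" "12 * \<rho> \<le> (1 / (4 * (real m + 1)))\<^sup>2"
  obtains t where "1 / 2 \<le> t" "t \<le> 3 / 4"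
    "\<And>i. i < m \<Longrightarrow> 0 \<le> l i (periodic_vec n (pseudo_vec \<rho> t)) (periodic_mat n (pseudo_mat \<rho> t))"
proof -
  define \<tau> where "\<tau> j = 1 / 2 + real j / (4 * (real m + 1))" for j
  define val where "val i j = l i (periodic_vec n (pseudo_vec \<rho> (\<tau> j))) (periodic_mat n (pseudo_mat \<rho> (\<tau> j)))" for i j
  have \<tau>: "1 / 2 \<le> \<tau> j" "\<tau> j \<le> 3 / 4" if "j \<le> m" for j
    using that by (auto simp: \<tau>_def field_simps)
  have "\<exists>j\<le>m. \<forall>i<m. 0 \<le> val i j"
  proof (rule ccontr)
    assume "\<not> ?thesis"
    then have "\<forall>j\<le>m. \<exists>i<m. val i j < 0" by (meson not_le)
    then obtain f where f: "\<And>j. j \<le> m \<Longrightarrow> f j < m \<and> val (f j) j < 0"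
      by metis
    have "inj_on f {..m}"
    proof (rule inj_onI, rule ccontr)
      fix j k assume jk: "j \<in> {..m}" "k \<in> {..m}" "f j = f k" "j \<noteq> k"
      have "1 \<le> \<bar>real j - real k\<bar>" using jk(4) by linarith
      then have "1 / (4 * (real m + 1)) \<le> \<bar>real j - real k\<bar> / (4 * (real m + 1))"
        by (intro divide_right_mono) auto
      also have "\<dots> = \<bar>\<tau> j - \<tau> k\<bar>"
        by (simp add: \<tau>_def flip: diff_divide_distrib)
      finally have "(1 / (4 * (real m + 1)))\<^sup>2 \<le> \<bar>\<tau> j - \<tau> k\<bar>\<^sup>2" by (intro power_mono) auto
      then have "12 * \<rho> \<le> (\<tau> j - \<tau> k)\<^sup>2" using \<rho>(3) by simp
      moreover have "val (f j) j < 0" "val (f j) k < 0" "f j < m" using f jk by (auto, metis f)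
      ultimately show False
        using cut_cannot_violate_two_pseudo_moments [OF cuts \<rho>(1,2) \<tau> \<tau>, of "f j" j k] jk
        by (auto simp: val_def)
    qed
    moreover have "f ` {..m} \<subseteq> {..<m}" using f by auto
    ultimately have "card {..m} \<le> card {..<m}" by (meson card_inj_on_le finite_lessThan)
    then show False by simp
  qed
  then show ?thesis using that \<tau> unfolding val_def by blast
qed

theorem theorem3:
  shows "\<exists>\<kappa>::real. \<kappa> > 0 \<and>
    (\<forall>(n::nat) (m::nat) (l :: nat \<Rightarrow> real vec \<Rightarrow> real mat \<Rightarrow> real).
       n \<ge> 4 \<longrightarrow> (\<forall>i<m. valid_cut n (l i)) \<longrightarrow>
       (\<exists>(Q, c) \<in> normalized_instances n.
          relaxation_gap n m l Q c \<ge> ereal (\<kappa> * real n / (real m + 1)^2)))"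
proof (intro exI [of _ "1 / 160000000 :: real"] conjI allI impI)
  fix n m :: nat and l :: "nat \<Rightarrow> real vec \<Rightarrow> real mat \<Rightarrow> real"
  assume n: "n \<ge> 4" and cuts: "\<forall>i<m. valid_cut n (l i)"
  \<comment> \<open>The factor \<open>1 / 1000000\<close> keeps the pseudo-moments positive semidefinite; the order
     \<open>1 / (m + 1)\<^sup>2\<close> is the square of the spacing.  The constant \<open>160000000\<close> is the product of
     \<open>1000000\<close>, of 8 from \<open>n \<le> 8 * (n div 4)\<close> and of 20 from \<open>4 * (4 + \<rho>) \<le> 20\<close>.\<close>
  define \<rho> where "\<rho> = 1 / 1000000 / (real m + 1)\<^sup>2"
  have m: "1 \<le> (real m + 1)\<^sup>2" by (simp add: one_le_power)
  have "12 * \<rho> = 12 / 1000000 / (real m + 1)\<^sup>2" by (simp add: \<rho>_def)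
  also have "\<dots> \<le> 1 / 16 / (real m + 1)\<^sup>2" by (intro divide_right_mono) auto
  also have "\<dots> = (1 / (4 * (real m + 1)))\<^sup>2" unfolding power_divide power_mult_distrib by simp
  finally have \<rho>: "0 \<le> \<rho>" "\<rho> \<le> 1 / 1000000" "12 * \<rho> \<le> (1 / (4 * (real m + 1)))\<^sup>2"
    using m by (simp_all add: \<rho>_def field_simps)
  obtain t where t: "1 / 2 \<le> t" "t \<le> 3 / 4" and
    feas: "\<And>i. i < m \<Longrightarrow> 0 \<le> l i (periodic_vec n (pseudo_vec \<rho> t)) (periodic_mat n (pseudo_mat \<rho> t))"
    using unviolated_pseudo_moment [where \<rho> = \<rho> and l = l and m = m and n = n] cuts \<rho> by blast
  have "n \<le> 8 * (n div 4)"
    using n by presburger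
  then have "real n \<le> 8 * real (n div 4)"
    by linarith
  then have "1 / 160000000 * real n / (real m + 1)\<^sup>2 \<le> 1 / 160000000 * (8 * real (n div 4)) / (real m + 1)\<^sup>2"
    by (intro divide_right_mono mult_left_mono) auto
  also have "\<dots> = real (n div 4) * (\<rho> / 20)" by (simp add: \<rho>_def)
  also have "\<dots> \<le> real (n div 4) * (\<rho> / (4 * (4 + \<rho>)))"
    using \<rho> by (intro mult_left_mono divide_left_mono) auto
  finally have "ereal (1 / 160000000 * real n / (real m + 1)\<^sup>2)
      \<le> relaxation_gap n m l (instance_Q n) (instance_c n t)"
    using instance_gap [where l = l and m = m and n = n, OF \<rho>(1,2) t feas] by (meson ereal_less_eq(3) order_trans)
  moreover have "(instance_Q n, instance_c n t) \<in> normalized_instances n"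
    using t by (intro instance_normalized) auto
  ultimately show "\<exists>(Q, c) \<in> normalized_instances n.
      relaxation_gap n m l Q c \<ge> ereal (1 / 160000000 * real n / (real m + 1)^2)"
    by (intro bexI [of _ "(instance_Q n, instance_c n t)"]) auto
qed simp

end
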